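(* Let $n\in\{1,2,\ldots\}$, $\beta\in(0,1)$, and let $$M_{\mathrm{CP},n}(x):=K_{\mathrm{CP},n,\frac{1+\beta}2}(x)\cap\Lambda_{\mathrm{CP},n,\frac{1+\beta}2}(x)\qquad\text{for }x\in\{0,\ldots,n\}$$ be the two-sided Clopper-Pearson interval. If $\beta\ge2\beta_n-1$ or $n=1$, hence in particular if $\beta\ge\frac12$, then $M_{\mathrm{CP},n}$ is a $\beta$-confidence interval for the average success probability, that is, each $M_{\mathrm{CP},n}(x)$ is an interval and $$\mathrm{BC}_p\big(\{x\in\{0,\ldots,n\} : \overline p\in M_{\mathrm{CP},n}(x)\}\big)\ge\beta\quad\text{for every }p\in[0,1]^n.$$
   Context: $\mathrm{B}_{n,p}$ is the binomial law with parameters $n$ and $p\in[0,1]$. For $p=(p_1,\ldots,p_n)\in[0,1]^n$, $\mathrm{BC}_p$ is the Bernoulli convolution (Poisson-binomial law), i.e. the law of the sum of $n$ independent Bernoulli variables with success probabilities $p_1,\ldots,p_n$, and $\overline p:=\frac1n\sum_{j=1}^n p_j$. For $\gamma\in(0,1)$ and $x\in\{1,\ldots,n\}$, $g_{n,\gamma}(x)$ denotes the unique $p\in[0,1]$ with $\mathrm{B}_{n,p}(\{x,\ldots,n\})=1-\gamma$. The Clopper-Pearson upray is $K_{\mathrm{CP},n,\gamma}(0):=[0,1]$ and $K_{\mathrm{CP},n,\gamma}(x):=(g_{n,\gamma}(x),1]$ for $x\in\{1,\ldots,n\}$; the Clopper-Pearson downray is $\Lambda_{\mathrm{CP},n,\gamma}(x):=\{1-t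 : t\in K_{\mathrm{CP},n,\gamma}(n-x)\}$ for $x\in\{0,\ldots,n\}$. Put $\beta_n:=\mathrm{B}_{n,1/n}(\{0,1\})$. *)

theory Defs
  imports "HOL-Probability.Probability"
begin

text \<open>Only the values \<open>p 1, \<dots>, p n\<close> of a parameter sequence are used.\<close>

definition bernoulli_convolution :: "nat \<Rightarrow> (nat \<Rightarrow> real) \<Rightarrow> nat pmf" where
  "bernoulli_convolution n p =
     map_pmf (\<lambda>\<omega>. \<Sum>j=1..n. of_bool (\<omega> j))
       (Pi_pmf {1..n} False (\<lambda>j. bernoulli_pmf (p j)))"

definition average :: "nat \<Rightarrow> (nat \<Rightarrow> real) \<Rightarrow> real" where
  "average n p = (1 / real n) * (\<Sum>j=1..n. p j)"

text \<open>The description is proper for \<open>0 < \<gamma> < 1\<close> and \<open>1 \<le> x \<le> n\<close>: then the upper tail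
  probability is continuous and strictly increasing in \<open>p\<close>, from \<open>0\<close> to \<open>1\<close>.\<close>

definition g_CP :: "nat \<Rightarrow> real \<Rightarrow> nat \<Rightarrow> real" where
  "g_CP n \<gamma> x =
     (THE p. p \<in> {0..1} \<and> measure_pmf.prob (binomial_pmf n p) {x..n} = 1 - \<gamma>)"

definition K_CP :: "nat \<Rightarrow> real \<Rightarrow> nat \<Rightarrow> real set" where
  "K_CP n \<gamma> x = (if x = 0 then {0..1} else {g_CP n \<gamma> x<..1})"

definition Lambda_CP :: "nat \<Rightarrow> real \<Rightarrow> nat \<Rightarrow> real set" where
  "Lambda_CP n \<gamma> x = (\<lambda>t. 1 - t) ` K_CP n \<gamma> (n - x)"

definition M_CP :: "nat \<Rightarrow> real \<Rightarrow> nat \<Rightarrow> real set" where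
  "M_CP n \<beta> x = K_CP n ((1 + \<beta>) / 2) x \<inter> Lambda_CP n ((1 + \<beta>) / 2) x"

definition beta_n :: "nat \<Rightarrow> real" where
  "beta_n n = measure_pmf.prob (binomial_pmf n (1 / real n)) {0, 1}"

definition confidence_interval_for_average ::
    "nat \<Rightarrow> real \<Rightarrow> (nat \<Rightarrow> real set) \<Rightarrow> bool" where
  "confidence_interval_for_average n \<beta> M \<longleftrightarrow>
     (\<forall>x\<in>{0..n}. is_interval (M x)) \<and>
     (\<forall>p. (\<forall>j\<in>{1..n}. p j \<in> {0..1}) \<longrightarrow>
        measure_pmf.prob (bernoulli_convolution n p) {x \<in> {0..n}. average n p \<in> M x} \<ge> \<beta>)"

end

theory Submission
  imports Defs
begin

text \<open>
  Write \<open>\<gamma> = (1 + \<beta>) / 2\<close>, let \<open>S\<close> be the sum of the Bernoulli variables and \<open>a\<close> the average of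
  their success probabilities. The interval misses \<open>a\<close> on the upper side if \<open>S = x\<close> with
  \<open>a \<le> g(x)\<close>, that is \<open>B\<^bsub>n,a\<^esub>({x..n}) \<le> 1 - \<gamma>\<close>. These \<open>x\<close> lie in \<open>{c..n}\<close> with \<open>c\<close> the least of
  them. A miss on the lower side is a miss on the upper side for \<open>n - S\<close>, whose success
  probabilities are \<open>1 - p j\<close>. The two miss probabilities must not exceed
  \<open>1 - \<beta> = 2 * (1 - \<gamma>)\<close> together.

  A side with \<open>c \<ge> 2\<close> costs at most \<open>1 - \<gamma>\<close> (\<open>prob_missed_le\<close>). This rests on an inequality of
  Hoeffding (\<open>hoeffding_lower_sum\<close>): for an integer \<open>d \<ge> n * a\<close>, the probability of \<open>S \<le> d\<close> is
  smallest when all success probabilities are equal, so \<open>S\<close> exceeds \<open>d\<close> no more often than the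
  binomial variable that calibrates the interval. It applies with \<open>d = c - 1\<close> provided that
  \<open>a \<le> (c - 1) / n\<close>. For larger \<open>a\<close> the value \<open>B\<^bsub>n,a\<^esub>({0..c - 1})\<close> would lie strictly below
  \<open>B\<^bsub>n,(c - 1)/n\<^esub>({0..c - 1})\<close>, and this is at most \<open>\<beta>\<^sub>n \<le> \<gamma>\<close> by \<open>lower_at_mean_le_one\<close>, contrary
  to the definition of \<open>c\<close>.

  If \<open>c = 1\<close> on one side, Hoeffding's inequality with \<open>d = 0\<close> would require \<open>a = 0\<close>, and this side
  alone can cost more than \<open>1 - \<gamma>\<close>. But then \<open>(1 - a) ^ n \<ge> \<gamma> > 1 / 2\<close>, so \<open>a\<close> is so small that the other side costs nothing
  (\<open>missed_reflection_empty\<close>), while the probability of \<open>S \<ge> 1\<close> is at most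
  \<open>n * a \<le> 2 * (1 - (1 - a) ^ n) \<le> 2 * (1 - \<gamma>)\<close> (\<open>prob_missed_le_double\<close>).

  The final clause about \<open>\<beta> \<ge> 1 / 2\<close> says that \<open>\<beta>\<^sub>n \<le> 3 / 4 = \<beta>\<^sub>2\<close> for \<open>n \<ge> 2\<close>. Both this and
  \<open>lower_at_mean_le_one\<close> are obtained from Hoeffding's inequality itself, by appending to \<open>n\<close> equal
  success probabilities one that is \<open>0\<close> or \<open>1\<close>.
\<close>

section \<open>Generating polynomials of sums of independent Bernoulli variables\<close>

text \<open>The probability generating function of a sum of independent Bernoulli variables. As a polynomial
  it is visibly symmetric in the success probabilities, and pairs of factors can be split off.\<close>

definition success_poly :: "'a set \<Rightarrow> ('a \<Rightarrow> real) \<Rightarrow> real poly" where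
  "success_poly A p = (\<Prod>j\<in>A. [:1 - p j, p j:])"

definition lower_sum :: "nat \<Rightarrow> real poly \<Rightarrow> real" where
  "lower_sum d r = (\<Sum>k\<le>d. coeff r k)"

lemma success_poly_insert:
  assumes "finite A" "i \<notin> A"
  shows "success_poly (insert i A) p = [:1 - p i, p i:] * success_poly A p"
  using assms by (simp add: success_poly_def del: mult_pCons_left)

lemma success_poly_const: "success_poly A (\<lambda>_. a) = [:1 - a, a:] ^ card A"
  by (simp add: success_poly_def)

lemma success_poly_cong:
  "(\<And>j. j \<in> A \<Longrightarrow> p j = q j) \<Longrightarrow> success_poly A p = success_poly A q"
  unfolding success_poly_def by (rule prod.cong) auto

lemma coeff_linear_factor:
  "coeff ([:1 - x, x:] * r) k
     = (1 - x) * coeff r k + x * (if k = 0 then 0 else coeff r (k - 1))" for x :: real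
  by (cases k) simp_all

lemma coeff_success_poly_nonneg:
  assumes "finite A" "\<And>j. j \<in> A \<Longrightarrow> 0 \<le> p j \<and> p j \<le> 1"
  shows "0 \<le> coeff (success_poly A p) k"
  using assms
proof (induction A arbitrary: k rule: finite_induct)
  case empty
  then show ?case by (simp add: success_poly_def)
next
  case (insert i A)
  then show ?case
    by (simp add: success_poly_insert coeff_linear_factor del: mult_pCons_left)
qed

lemma continuous_on_coeff_success_poly:
  assumes "finite A"
  shows "continuous_on UNIV (\<lambda>p :: 'a \<Rightarrow> real. coeff (success_poly A p) k)"
  using assms
proof (induction A arbitrary: k rule: finite_induct)
  case empty
  then show ?case by (simp add: success_poly_def)
next
  case (insert i A)
  show ?case
  proof (cases k)
    case 0
    show ?thesis
      by (simp add: 0 success_poly_insert insert.hyps coeff_linear_factor del: mult_pCons_left)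
         (intro continuous_intros insert.IH continuous_on_product_coordinates)
  next
    case (Suc l)
    show ?thesis
      by (simp add: Suc success_poly_insert insert.hyps coeff_linear_factor del: mult_pCons_left)
         (intro continuous_intros insert.IH continuous_on_product_coordinates)
  qed
qed

text \<open>Conditioning on one variable: it turns a sum that is at most \<open>d\<close> into a larger one exactly if the
  others sum to \<open>d\<close> and it succeeds.\<close>

lemma lower_sum_linear_factor:
  "lower_sum d ([:1 - x, x:] * r) = lower_sum d r - x * coeff r d" for x :: real
  unfolding lower_sum_def
proof (induction d)
  case 0
  then show ?case by (simp add: algebra_simps)
next
  case (Suc d)
  then show ?case
    by (simp add: coeff_linear_factor algebra_simps del: mult_pCons_left)
qed

text \<open>The coefficient of index \<open>-1\<close> counts as \<open>0\<close>; this makes the next lemma uniform in \<open>d\<close>.\<close>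

definition coeff_drop :: "nat \<Rightarrow> real poly \<Rightarrow> real" where
  "coeff_drop d r = coeff r d - (if d = 0 then 0 else coeff r (d - 1))"

text \<open>If \<open>x + y\<close> is held fixed, only the last summand varies. Its sign decides whether two success
  probabilities should be moved together or apart in order to decrease the lower sum.\<close>

lemma lower_sum_two_linear_factors:
  "lower_sum d ([:1 - x, x:] * ([:1 - y, y:] * r))
     = lower_sum d r - (x + y) * coeff r d + x * y * coeff_drop d r" for x y :: real
  by (simp only: lower_sum_linear_factor coeff_linear_factor coeff_drop_def)
     (simp add: algebra_simps)

section \<open>Hoeffding's inequality for the lower tail\<close>

text \<open>Beyond the mode, which is at most \<open>(m + 1) * a\<close>, binomial probabilities decrease.\<close>

lemma coeff_binomial_decreasing:
  fixes a :: real
  assumes a: "0 < a" "a < 1" and j: "real (m + 1) * a \<le> real (Suc i)"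
  shows "coeff ([:1 - a, a:] ^ m) (Suc i) \<le> coeff ([:1 - a, a:] ^ m) i"
proof (cases "i < m")
  case False
  have "degree ([:1 - a, a:] ^ m) \<le> m"
    using degree_power_le[of "[:1 - a, a:]" m] a by simp
  then have "coeff ([:1 - a, a:] ^ m) (Suc i) = 0"
    using False by (intro coeff_eq_0) linarith
  moreover have "0 \<le> coeff ([:1 - a, a:] ^ m) i"
    using coeff_success_poly_nonneg[of "{..<m}" "\<lambda>_. a" i] a
    by (simp add: success_poly_const)
  ultimately show ?thesis by simp
next
  case True
  then obtain l where l: "m = Suc (i + l)"
    using less_imp_Suc_add by blast
  define C where "C = real (m choose i) * a ^ i * (1 - a) ^ l"
  have C: "0 \<le> C" using a by (simp add: C_def)
  have "real (Suc i) * real (m choose Suc i) = real (m choose i) * real (m - i)"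
    using binomial_absorb_comp[of m i] binomial_absorption[of i m]
    by (metis mult.commute of_nat_mult)
  then have *: "real (m choose Suc i) = real (m choose i) * real (Suc l) / real (Suc i)"
    by (simp add: field_simps l)
  have "coeff ([:1 - a, a:] ^ m) (Suc i) = C * (real (Suc l) * a / real (Suc i))"
    using l by (subst coeff_linear_poly_power) (simp_all add: *[unfolded l] C_def del: binomial_Suc_Suc)
  also have "\<dots> \<le> C * (1 - a)"
  proof (intro mult_left_mono C)
    have "real (Suc l) * a \<le> (1 - a) * real (Suc i)"
      using j by (simp add: l algebra_simps)
    then show "real (Suc l) * a / real (Suc i) \<le> 1 - a"
      by (simp add: pos_divide_le_eq del: of_nat_Suc)
  qed
  also have "\<dots> = coeff ([:1 - a, a:] ^ m) i"
    using l by (subst coeff_linear_poly_power) (simp_all add: C_def Suc_diff_le del: binomial_Suc_Suc)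
  finally show ?thesis .
qed

text \<open>Zeros contribute trivial factors and ones only shift, so the polynomial is a shifted binomial one.\<close>

lemma success_poly_three_values:
  assumes "finite B" "\<And>j. j \<in> B \<Longrightarrow> q j \<in> {0, a, 1}"
  shows "\<exists>r m. success_poly B q = monom 1 r * [:1 - a, a:] ^ m \<and> (\<Sum>j\<in>B. q j) = real r + real m * a"
  using assms
proof (induction B rule: finite_induct)
  case empty
  show ?case by (intro exI[of _ 0]) (simp add: success_poly_def)
next
  case (insert i B)
  then obtain r m where rm: "success_poly B q = monom 1 r * [:1 - a, a:] ^ m"
    "(\<Sum>j\<in>B. q j) = real r + real m * a" by auto
  have ins: "success_poly (insert i B) q = [:1 - q i, q i:] * (monom 1 r * [:1 - a, a:] ^ m)"
    using insert.hyps by (simp add: success_poly_insert rm del: mult_pCons_left)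
  have sum: "(\<Sum>j\<in>insert i B. q j) = q i + real r + real m * a"
    using insert.hyps rm by simp
  have "q i = 0 \<or> q i = a \<or> q i = 1" using insert.prems by auto
  then show ?case
  proof (elim disjE)
    assume "q i = 0"
    then show ?thesis using ins sum by (intro exI[of _ r] exI[of _ m]) simp
  next
    assume "q i = a"
    then show ?thesis using ins sum
      by (intro exI[of _ r] exI[of _ "Suc m"]) (simp add: algebra_simps del: mult_pCons_left)
  next
    assume "q i = 1"
    then show ?thesis using ins sum
      by (intro exI[of _ "Suc r"] exI[of _ m])
         (simp add: monom_Suc)
  qed
qed

text \<open>After removing the shift by the number of ones, \<open>d\<close> lies beyond the mode of the binomial law.
  The summand \<open>a\<close> in the hypothesis on \<open>d\<close> is what the two coordinates outside \<open>B\<close> contribute at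
  least in the proof of \<open>hoeffding_lower_sum\<close>.\<close>

lemma coeff_drop_three_values:
  fixes a :: real
  assumes "finite B" "\<And>j. j \<in> B \<Longrightarrow> q j \<in> {0, a, 1}" and a: "0 < a" "a < 1"
    and d: "(\<Sum>j\<in>B. q j) + a \<le> real d"
  shows "coeff_drop d (success_poly B q) \<le> 0"
proof -
  obtain r m where rm: "success_poly B q = monom 1 r * [:1 - a, a:] ^ m"
    "(\<Sum>j\<in>B. q j) = real r + real m * a"
    using success_poly_three_values[where q = q, OF assms(1,2)] by blast
  have "real r < real d" using d rm a by (smt (verit) mult_nonneg_nonneg of_nat_0_le_iff)
  then obtain i where i: "d = r + Suc i"
    using less_imp_Suc_add by fastforce
  have "real (m + 1) * a \<le> real (Suc i)"
    using d rm i by (simp add: algebra_simps)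
  from coeff_binomial_decreasing[OF a this] show ?thesis
    by (simp add: coeff_drop_def rm coeff_monom_mult i)
qed

text \<open>Compactness provides a minimizer of the lower sum under the constraint on the mean. Among the
  minimizers one with the least sum of squares is chosen, because minimizers need not be unique:
  the second criterion excludes those that could be equalized at no cost.\<close>

lemma hoeffding_minimizer:
  fixes p :: "'a \<Rightarrow> real"
  assumes A: "finite A" and p: "\<And>j. j \<in> A \<Longrightarrow> 0 \<le> p j \<and> p j \<le> 1"
  obtains q where "\<forall>j\<in>A. 0 \<le> q j \<and> q j \<le> 1" "(\<Sum>j\<in>A. q j) = (\<Sum>j\<in>A. p j)"
    "lower_sum d (success_poly A q) \<le> lower_sum d (success_poly A p)"
    "\<forall>q'. (\<forall>j\<in>A. 0 \<le> q' j \<and> q' j \<le> 1) \<and> (\<Sum>j\<in>A. q' j) = (\<Sum>j\<in>A. q j) \<longrightarrow>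
       lower_sum d (success_poly A q) \<le> lower_sum d (success_poly A q') \<and>
       (lower_sum d (success_poly A q') = lower_sum d (success_poly A q) \<longrightarrow>
          (\<Sum>j\<in>A. (q j)\<^sup>2) \<le> (\<Sum>j\<in>A. (q' j)\<^sup>2))"
proof -
  let ?L = "\<lambda>q. lower_sum d (success_poly A q)"
  let ?Q = "\<lambda>q :: 'a \<Rightarrow> real. \<Sum>j\<in>A. (q j)\<^sup>2"
  define cut where "cut q = (\<lambda>j. if j \<in> A then q j else 0)" for q :: "'a \<Rightarrow> real"
  \<comment> \<open>Coordinates outside \<open>A\<close> are pinned to \<open>0\<close>, which makes the feasible set compact in the
    product topology.\<close>
  define C where "C = (\<Pi>\<^sub>E j\<in>UNIV. if j \<in> A then {0..1::real} else {0}) \<inter> {q. (\<Sum>j\<in>A. q j) = (\<Sum>j\<in>A. p j)}"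
  have coord: "continuous_on S (\<lambda>q :: 'a \<Rightarrow> real. q j)" for S j
    by (rule continuous_on_subset[OF continuous_on_product_coordinates]) simp
  have contL: "continuous_on S ?L" for S
    unfolding lower_sum_def
    by (intro continuous_on_sum continuous_on_subset[OF continuous_on_coeff_success_poly] A) simp
  have contQ: "continuous_on S ?Q" for S
    by (intro continuous_intros coord)
  have contS: "continuous_on UNIV (\<lambda>q. \<Sum>j\<in>A. q j :: real)"
    by (intro continuous_intros coord)
  have "compactin (product_topology (\<lambda>_. euclidean) UNIV)
          (\<Pi>\<^sub>E j\<in>UNIV. if j \<in> A then {0..1::real} else {0})"
    by (subst compactin_PiE) simp
  then have "compact (\<Pi>\<^sub>E j\<in>UNIV. if j \<in> A then {0..1::real} else {0})"
    by (simp add: euclidean_product_topology)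
  moreover have "closed {q :: 'a \<Rightarrow> real. (\<Sum>j\<in>A. q j) = (\<Sum>j\<in>A. p j)}"
    by (intro closed_Collect_eq contS continuous_intros)
  ultimately have C: "compact C"
    unfolding C_def by (rule compact_Int_closed)
  have cutC: "cut q \<in> C" if "\<And>j. j \<in> A \<Longrightarrow> 0 \<le> q j \<and> q j \<le> 1" "(\<Sum>j\<in>A. q j) = (\<Sum>j\<in>A. p j)" for q
    using that by (auto simp: C_def cut_def)
  have cut: "?L (cut q) = ?L q" "?Q (cut q) = ?Q q" for q
    by (auto simp: cut_def cong: success_poly_cong)
  have cutp: "cut p \<in> C" by (rule cutC) (use p in auto)
  then have "C \<noteq> {}" by auto
  from continuous_attains_inf[OF C this contL] obtain q0 where q0: "q0 \<in> C" "\<forall>q\<in>C. ?L q0 \<le> ?L q"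
    by blast
  define D where "D = C \<inter> {q. ?L q \<le> ?L q0}"
  have "compact D"
    unfolding D_def by (intro compact_Int_closed C closed_Collect_le contL continuous_intros)
  moreover have "D \<noteq> {}" using q0 by (auto simp: D_def)
  ultimately obtain q where q: "q \<in> D" "\<forall>q'\<in>D. ?Q q \<le> ?Q q'"
    using continuous_attains_inf[OF _ _ contQ] by blast
  have qC: "q \<in> C" and Lq: "?L q = ?L q0"
    using q q0 by (auto simp: D_def intro: antisym)
  have sumq: "(\<Sum>j\<in>A. q j) = (\<Sum>j\<in>A. p j)" using qC by (simp add: C_def)
  show thesis
  proof (rule that[of q])
    show "\<forall>j\<in>A. 0 \<le> q j \<and> q j \<le> 1"
      using qC by (auto simp: C_def PiE_iff split: if_splits)
    show "(\<Sum>j\<in>A. q j) = (\<Sum>j\<in>A. p j)" by (rule sumq)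
    show "?L q \<le> ?L p" using q0(2) cutp cut(1)[of p] Lq by fastforce
  next
    show "\<forall>q'. (\<forall>j\<in>A. 0 \<le> q' j \<and> q' j \<le> 1) \<and> (\<Sum>j\<in>A. q' j) = (\<Sum>j\<in>A. q j) \<longrightarrow>
       ?L q \<le> ?L q' \<and> (?L q' = ?L q \<longrightarrow> ?Q q \<le> ?Q q')"
    proof (intro allI impI)
      fix q' assume q': "(\<forall>j\<in>A. 0 \<le> q' j \<and> q' j \<le> 1) \<and> (\<Sum>j\<in>A. q' j) = (\<Sum>j\<in>A. q j)"
      have c: "cut q' \<in> C" using cutC q' sumq by simp
      have "?L q \<le> ?L q'" using q0(2) c cut(1)[of q'] Lq by fastforce
      moreover have "?Q q \<le> ?Q q'" if "?L q' = ?L q"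
      proof -
        have "cut q' \<in> D" using that c cut(1)[of q'] Lq by (simp add: D_def)
        then show ?thesis using q(2) cut(2)[of q'] by fastforce
      qed
      ultimately show "?L q \<le> ?L q' \<and> (?L q' = ?L q \<longrightarrow> ?Q q \<le> ?Q q')" by blast
    qed
  qed
qed

text \<open>At the minimizer of \<open>hoeffding_minimizer\<close>, averaging two unequal coordinates must increase the
  lower sum, so \<open>coeff_drop\<close> is positive for the remaining ones. Spreading the two would then decrease the
  lower sum, so one of them is already at the boundary. Hence all coordinates strictly between \<open>0\<close>
  and \<open>1\<close> share one value \<open>a\<close>. In this three-valued situation \<open>coeff_drop\<close> is not positive after
  all, because \<open>d\<close> is at least the mean; so no two coordinates differ.\<close>

theorem hoeffding_lower_sum:
  fixes p :: "'a \<Rightarrow> real"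
  assumes A: "finite A" and ne: "A \<noteq> {}" and p: "\<And>j. j \<in> A \<Longrightarrow> 0 \<le> p j \<and> p j \<le> 1"
    and s: "(\<Sum>j\<in>A. p j) = real (card A) * s" and d: "real (card A) * s \<le> real d"
  shows "lower_sum d ([:1 - s, s:] ^ card A) \<le> lower_sum d (success_poly A p)"
proof -
  let ?L = "\<lambda>q. lower_sum d (success_poly A q)"
  obtain q where q01: "\<And>j. j \<in> A \<Longrightarrow> 0 \<le> q j \<and> q j \<le> 1" and qs: "(\<Sum>j\<in>A. q j) = (\<Sum>j\<in>A. p j)"
    and Lq: "?L q \<le> ?L p"
    and min: "\<And>q'. (\<And>j. j \<in> A \<Longrightarrow> 0 \<le> q' j \<and> q' j \<le> 1) \<Longrightarrow> (\<Sum>j\<in>A. q' j) = (\<Sum>j\<in>A. q j) \<Longrightarrow>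
       ?L q \<le> ?L q' \<and> (?L q' = ?L q \<longrightarrow> (\<Sum>j\<in>A. (q j)\<^sup>2) \<le> (\<Sum>j\<in>A. (q' j)\<^sup>2))"
    using hoeffding_minimizer[where p = p and d = d, OF A p] by metis
  have unequal: "0 < coeff_drop d (success_poly (A - {i, j}) q) \<and> (q i = 0 \<or> q j = 1)"
    if ij: "i \<in> A" "j \<in> A" "q i < q j" for i j
  proof -
    let ?r = "success_poly (A - {i, j}) q"
    define E where "E = coeff_drop d ?r"
    define move where "move x y = q(i := x, j := y)" for x y
    have neq: "i \<noteq> j" using ij by auto
    have split: "A = insert i (insert j (A - {i, j}))" using ij by auto
    have L: "?L q' = lower_sum d ?r - (q' i + q' j) * coeff ?r d + q' i * q' j * E"
      if "\<And>l. l \<in> A - {i, j} \<Longrightarrow> q' l = q l" for q'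
    proof -
      have "success_poly A q' = [:1 - q' i, q' i:] * ([:1 - q' j, q' j:] * success_poly (A - {i, j}) q')"
        using A neq by (subst split) (simp add: success_poly_insert del: mult_pCons_left)
      also have "success_poly (A - {i, j}) q' = ?r"
        using that by (rule success_poly_cong)
      finally show ?thesis by (simp only: lower_sum_two_linear_factors E_def)
    qed
    have sums: "(\<Sum>l\<in>A. h (move x y l)) = (\<Sum>l\<in>A. h (q l)) + (h x + h y - h (q i) - h (q j))"
      for h :: "real \<Rightarrow> real" and x y
    proof -
      have "(\<Sum>l\<in>A. h (q' l)) = h (q' i) + h (q' j) + (\<Sum>l\<in>A - {i, j}. h (q' l))" for q'
        using A neq by (subst split) simp
      moreover have "(\<Sum>l\<in>A - {i, j}. h (move x y l)) = (\<Sum>l\<in>A - {i, j}. h (q l))"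
        by (rule sum.cong) (auto simp: move_def)
      ultimately show ?thesis using neq by (simp add: move_def)
    qed
    have Lmove: "?L (move x y) = ?L q + (x * y - q i * q j) * E" if "x + y = q i + q j" for x y
      using L[of "move x y"] L[of q] that neq by (simp add: move_def algebra_simps)
    have minmove: "?L q \<le> ?L (move x y) \<and>
        (?L (move x y) = ?L q \<longrightarrow> (q i)\<^sup>2 + (q j)\<^sup>2 \<le> x\<^sup>2 + y\<^sup>2)"
      if "x + y = q i + q j" "0 \<le> x" "x \<le> 1" "0 \<le> y" "y \<le> 1" for x y
    proof -
      have "\<forall>l\<in>A. 0 \<le> move x y l \<and> move x y l \<le> 1"
        using that q01 by (simp add: move_def)
      moreover have "(\<Sum>l\<in>A. move x y l) = (\<Sum>l\<in>A. q l)"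
        using sums[of "\<lambda>t. t" x y] that by simp
      ultimately show ?thesis
        using min[of "move x y"] sums[of "\<lambda>t. t\<^sup>2" x y] by auto
    qed
    \<comment> \<open>Averaging the pair increases the product and strictly decreases the sum of squares.\<close>
    define m where "m = (q i + q j) / 2"
    have mm: "m * m - q i * q j = ((q j - q i) / 2)\<^sup>2"
      by (simp add: m_def power2_eq_square field_simps)
    have mpos: "0 < m * m - q i * q j" using ij unfolding mm by simp
    have m01: "0 \<le> m" "m \<le> 1" "m + m = q i + q j"
      using q01[OF ij(1)] q01[OF ij(2)] by (auto simp: m_def)
    have "(q i)\<^sup>2 + (q j)\<^sup>2 = m\<^sup>2 + m\<^sup>2 + 2 * ((q j - q i) / 2)\<^sup>2"
      by (simp add: m_def power2_eq_square field_simps)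
    then have sq: "m\<^sup>2 + m\<^sup>2 < (q i)\<^sup>2 + (q j)\<^sup>2" using ij by simp
    have "0 \<le> (m * m - q i * q j) * E" "(m * m - q i * q j) * E \<noteq> 0"
      using minmove[OF m01(3,1,2,1,2)] Lmove[OF m01(3)] sq by auto
    then have E: "0 < E" using mpos by (simp add: zero_le_mult_iff)
    have "q i = 0 \<or> q j = 1"
    proof (rule ccontr)
      assume "\<not> (q i = 0 \<or> q j = 1)"
      then have pos: "0 < q i" "q j < 1" using q01[OF ij(1)] q01[OF ij(2)] by auto
      \<comment> \<open>The largest step that moves the pair apart within the unit interval.\<close>
      define e where "e = min (q i) (1 - q j)"
      have e: "0 < e" "e \<le> q i" "e \<le> 1 - q j" using pos by (auto simp: e_def)
      have xy: "(q i - e) * (q j + e) - q i * q j = - (e * (q j - q i + e))"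
        by (simp add: algebra_simps)
      have "0 \<le> ((q i - e) * (q j + e) - q i * q j) * E"
        using minmove[of "q i - e" "q j + e"] Lmove[of "q i - e" "q j + e"] e
          q01[OF ij(1)] q01[OF ij(2)] by simp
      moreover have "0 < e * (q j - q i + e) * E" using e ij E by simp
      ultimately show False by (simp only: xy mult_minus_left)
    qed
    with E show ?thesis by (simp add: E_def)
  qed
  have const: "q i = q j" if inA: "i \<in> A" "j \<in> A" for i j
  proof (rule ccontr)
    assume "q i \<noteq> q j"
    then obtain i j where ij: "i \<in> A" "j \<in> A" "q i < q j"
      using inA by (metis linorder_neqE_linordered_idom)
    obtain a where a: "0 < a" "a < 1" and val: "\<forall>l\<in>A. q l \<in> {0, a, 1}"
    proof (cases "\<exists>l\<in>A. 0 < q l \<and> q l < 1")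
      case True
      then obtain k where k: "k \<in> A" "0 < q k" "q k < 1" by blast
      have "q l \<in> {0, q k, 1}" if "l \<in> A" for l
        using unequal[of l k] unequal[of k l] k that by fastforce
      then show thesis using k by (intro that[of "q k"]) auto
    next
      case False
      then have "q l \<in> {0, 1}" if "l \<in> A" for l
        using q01[OF that] that by fastforce
      \<comment> \<open>Without interior coordinates the value of \<open>a\<close> is arbitrary.\<close>
      then show thesis by (intro that[of "1 / 2"]) auto
    qed
    have "(\<Sum>l\<in>A. q l) = q i + q j + (\<Sum>l\<in>A - {i, j}. q l)"
    proof -
      have split: "A = insert i (insert j (A - {i, j}))" using ij by auto
      have "i \<noteq> j" using ij by auto
      then show ?thesis using A by (subst split) simp
    qed
    moreover have "a \<le> q j"
      using bspec[OF val ij(2)] ij(3) q01[OF ij(1)] a by auto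
    ultimately have "(\<Sum>l\<in>A - {i, j}. q l) + a \<le> real d"
      using qs s d q01[OF ij(1)] by simp
    then have "coeff_drop d (success_poly (A - {i, j}) q) \<le> 0"
      using A val by (intro coeff_drop_three_values[OF _ _ a]) auto
    then show False using unequal[OF ij] by simp
  qed
  obtain i where i: "i \<in> A" using ne by blast
  have "(\<Sum>j\<in>A. q j) = real (card A) * q i"
    using const[OF _ i] by simp
  then have "q i = s" using qs s A ne by simp
  then have "success_poly A q = [:1 - s, s:] ^ card A"
    using const[OF _ i] success_poly_cong[of A q "\<lambda>_. s"] by (simp add: success_poly_const)
  then show ?thesis using Lq by simp
qed

section \<open>Lower tails of binomial laws\<close>

lemma lower_sum_binomial_full: "n \<le> d \<Longrightarrow> lower_sum d ([:1 - a, a:] ^ n) = 1" for a :: real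
proof (induction n)
  case 0
  then show ?case by (induction d) (simp_all add: lower_sum_def)
next
  case (Suc n)
  have "degree ([:1 - a, a:] ^ n) \<le> degree [:1 - a, a:] * n"
    by (rule degree_power_le)
  also have "\<dots> \<le> n" by simp
  finally have "coeff ([:1 - a, a:] ^ n) d = 0"
    using Suc.prems by (intro coeff_eq_0) linarith
  then show ?case
    using Suc by (simp add: lower_sum_linear_factor del: mult_pCons_left)
qed

lemma lower_sum_binomial_but_last:
  "lower_sum k ([:1 - a, a:] ^ Suc k) = 1 - a ^ Suc k" for a :: real
proof -
  have "lower_sum (Suc k) ([:1 - a, a:] ^ Suc k) = lower_sum k ([:1 - a, a:] ^ Suc k) + a ^ Suc k"
    by (simp add: lower_sum_def coeff_linear_poly_power del: power_Suc)
  then show ?thesis using lower_sum_binomial_full[of "Suc k" "Suc k" a] by simp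
qed

text \<open>Conditioning on the last trial writes the lower tail for \<open>n + 1\<close> trials as a convex combination of
  two lower tails for \<open>n\<close> trials, with more weight on the smaller one if the success probability
  grows.\<close>

lemma lower_sum_binomial_strict_antimono:
  fixes a b :: real
  assumes "d < n" "0 \<le> a" "a < b" "b \<le> 1"
  shows "lower_sum d ([:1 - b, b:] ^ n) < lower_sum d ([:1 - a, a:] ^ n)"
  using assms(1)
proof (induction n arbitrary: d)
  case (Suc n)
  show ?case
  proof (cases "d = n")
    case True
    have "a ^ Suc n < b ^ Suc n" using assms by (intro power_strict_mono) auto
    then show ?thesis unfolding True lower_sum_binomial_but_last by simp
  next
    case False
    then have dn: "d < n" using Suc.prems by simp
    define G where "G t = lower_sum d ([:1 - t, t:] ^ n)" for t :: real
    \<comment> \<open>\<open>H\<close> is the lower tail up to \<open>d - 1\<close>, the empty sum for \<open>d = 0\<close>.\<close>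
    define H where "H t = (if d = 0 then 0 else lower_sum (d - 1) ([:1 - t, t:] ^ n))" for t :: real
    have c: "coeff ([:1 - t, t:] ^ n) d = G t - H t" for t
      by (cases d) (simp_all add: G_def H_def lower_sum_def)
    have step: "lower_sum d ([:1 - t, t:] ^ Suc n) = (1 - t) * G t + t * H t" for t
      by (simp add: lower_sum_linear_factor c algebra_simps flip: G_def del: mult_pCons_left)
    have G: "G b < G a" using Suc.IH[OF dn] by (simp add: G_def)
    have H: "H b \<le> H a"
      using Suc.IH[of "d - 1"] dn by (cases d) (auto simp: H_def intro: less_imp_le)
    have "0 \<le> coeff ([:1 - b, b:] ^ n) d"
      using coeff_success_poly_nonneg[of "{..<n}" "\<lambda>_. b" d] assms
      by (simp add: success_poly_const)
    then have HG: "H b \<le> G b" by (simp add: c)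
    have "(1 - b) * G b + b * H b = G b - b * (G b - H b)" by (simp add: algebra_simps)
    also have "\<dots> \<le> G b - a * (G b - H b)"
      using HG assms by (intro diff_left_mono mult_right_mono) auto
    also have "\<dots> = (1 - a) * G b + a * H b" by (simp add: algebra_simps)
    also have "\<dots> < (1 - a) * G a + a * H a"
      using G H assms by (intro add_less_le_mono mult_strict_left_mono mult_left_mono) auto
    finally show ?thesis by (simp only: step)
  qed
qed simp

lemma continuous_on_lower_sum_binomial:
  "continuous_on S (\<lambda>a. lower_sum d ([:1 - a, a:] ^ n))"
proof -
  have "continuous_on S (\<lambda>a. lower_sum d (success_poly {..<n} (\<lambda>_. a)))"
    unfolding lower_sum_def
    by (intro continuous_on_sum continuous_on_compose2[OF continuous_on_coeff_success_poly]
        continuous_on_coordinatewise_then_product continuous_intros) auto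
  then show ?thesis by (simp add: success_poly_const)
qed

text \<open>The probability \<open>B\<^bsub>n,k/n\<^esub>({0..k})\<close> that a binomial variable with the integer mean \<open>k\<close> does not
  exceed its mean. For \<open>k = 1\<close> this is \<open>\<beta>\<^sub>n\<close>.\<close>

definition lower_at_mean :: "nat \<Rightarrow> nat \<Rightarrow> real" where
  "lower_at_mean n k = lower_sum k ([:1 - real k / real n, real k / real n:] ^ n)"

text \<open>To \<open>n\<close> success probabilities \<open>k / n\<close> one more, equal to \<open>x\<close>, is appended. The sum of all becomes the
  integer \<open>k + x\<close>, so Hoeffding's inequality compares the result with the binomial law for \<open>n + 1\<close>
  trials whose mean is \<open>k + x\<close>.\<close>

lemma lower_at_mean_append:
  assumes "1 \<le> n" "k \<le> n" "x = 0 \<or> x = (1::nat)"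
  shows "lower_at_mean (Suc n) (k + x)
    \<le> lower_sum (k + x) ([:1 - real x, real x:] * [:1 - real k / real n, real k / real n:] ^ n)"
proof -
  define p where "p j = (if j = n then real x else real k / real n)" for j
  define s where "s = real (k + x) / real (Suc n)"
  have p01: "0 \<le> p j \<and> p j \<le> 1" for j
    using assms by (auto simp: p_def)
  have ins: "{..<Suc n} = insert n {..<n}" by auto
  have "(\<Sum>j<Suc n. p j) = real k + real x"
    using assms by (simp add: p_def)
  moreover have "real (Suc n) * s = real k + real x"
    by (simp add: s_def del: of_nat_Suc)
  moreover have "success_poly {..<Suc n} p
      = [:1 - real x, real x:] * [:1 - real k / real n, real k / real n:] ^ n"
  proof -
    have "success_poly {..<n} p = [:1 - real k / real n, real k / real n:] ^ n"
      using success_poly_cong[of "{..<n}" p "\<lambda>_. real k / real n"]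
      by (simp add: p_def success_poly_const)
    then show ?thesis
      unfolding ins by (simp add: success_poly_insert p_def del: mult_pCons_left)
  qed
  ultimately show ?thesis
    using hoeffding_lower_sum[of "{..<Suc n}" p s "k + x"] p01
    by (simp add: lower_at_mean_def lessThan_empty_iff s_def del: mult_pCons_left power_Suc of_nat_Suc lessThan_Suc)
qed

lemma lower_at_mean_append_failure:
  assumes "1 \<le> n" "k \<le> n"
  shows "lower_at_mean (Suc n) k \<le> lower_at_mean n k"
  using lower_at_mean_append[of n k 0] assms
  by (simp add: lower_sum_linear_factor del: mult_pCons_left) (simp add: lower_at_mean_def)

lemma lower_at_mean_append_success:
  assumes "1 \<le> n" "k \<le> n"
  shows "lower_at_mean (Suc n) (Suc k) \<le> lower_at_mean n k"
proof -
  have "lower_sum (Suc k) ([:1 - 1, 1:] * r) = lower_sum k r" for r :: "real poly"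
    unfolding lower_sum_linear_factor by (simp add: lower_sum_def)
  then show ?thesis
    using lower_at_mean_append[of n k 1] assms by (simp add: lower_at_mean_def)
qed

lemma lower_at_mean_antimono:
  assumes "m \<le> n" "1 \<le> m" "k \<le> m"
  shows "lower_at_mean n k \<le> lower_at_mean m k"
  using assms(1)
proof (induction n rule: dec_induct)
  case (step n)
  then show ?case using lower_at_mean_append_failure[of n k] assms by simp
qed simp

lemma lower_at_mean_diagonal:
  assumes "k \<le> l"
  shows "lower_at_mean (Suc l) l \<le> lower_at_mean (Suc k) k"
  using assms
proof (induction l rule: dec_induct)
  case (step l)
  then show ?case using lower_at_mean_append_success[of "Suc l" l] by simp
qed simp

lemma lower_at_mean_but_last:
  "lower_at_mean (Suc k) k = 1 - (real k / real (Suc k)) ^ Suc k"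
  by (simp add: lower_at_mean_def lower_sum_binomial_but_last del: power_Suc of_nat_Suc)

text \<open>It suffices to bound the value for some \<open>N \<ge> n\<close>, since it decreases in the number of trials. There
  it is at least \<open>2 * (1 - 1 / N) ^ N\<close>, and \<open>(1 - 1 / N) ^ N\<close> increases in \<open>N\<close> by
  \<open>lower_at_mean_diagonal\<close>. The limit \<open>2 / e\<close> exceeds \<open>19 / 27\<close>, and \<open>N = 12\<close> is the first value for
  which this lower bound does.\<close>

lemma lower_at_mean_one_ge:
  assumes "1 \<le> n"
  shows "19 / 27 \<le> lower_at_mean n 1"
proof -
  define m where "m = max (n - 1) 11"
  define u where "u = real m / real (Suc m)"
  have u: "0 \<le> u" "u \<le> 1" by (simp_all add: u_def)
  have "1 - u ^ Suc m \<le> 1 - (11 / 12) ^ 12"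
    using lower_at_mean_diagonal[of 11 m] unfolding lower_at_mean_but_last by (simp add: u_def m_def)
  then have "2 * (11 / 12) ^ 12 \<le> 2 * u ^ Suc m" by simp
  also have "\<dots> \<le> u ^ Suc m + u ^ m"
    using u by (simp add: mult_left_le_one_le)
  also have "\<dots> = lower_at_mean (Suc m) 1"
  proof -
    have eq: "1 - real 1 / real (Suc m) = u" by (simp add: u_def field_simps)
    have "lower_at_mean (Suc m) 1 = u ^ Suc m + real (Suc m) * (real 1 / real (Suc m)) * u ^ m"
      unfolding lower_at_mean_def lower_sum_def eq
      by (simp add: coeff_linear_poly_power atMost_Suc del: of_nat_Suc power_Suc)
    then show ?thesis by simp
  qed
  also have "\<dots> \<le> lower_at_mean n 1"
    using assms by (intro lower_at_mean_antimono) (auto simp: m_def)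
  finally have "2 * (11 / 12) ^ 12 \<le> lower_at_mean n 1" .
  moreover have "19 / 27 \<le> 2 * (11 / 12 :: real) ^ 12" by (simp add: power_divide)
  ultimately show ?thesis by linarith
qed

text \<open>For \<open>k \<ge> 2\<close> the constant \<open>19 / 27 = lower_at_mean 3 2\<close> separates the two sides: failures and
  successes are removed one by one until \<open>n = 3\<close> and \<open>k = 2\<close>.\<close>

lemma lower_at_mean_le_one:
  assumes "1 \<le> k" "k < n"
  shows "lower_at_mean n k \<le> lower_at_mean n 1"
proof (cases "k = 1")
  case False
  have "lower_at_mean n k \<le> lower_at_mean (Suc k) k"
    using assms by (intro lower_at_mean_antimono) auto
  also have "\<dots> \<le> lower_at_mean (Suc 2) 2"
    using assms False by (intro lower_at_mean_diagonal) auto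
  also have "\<dots> = 19 / 27"
    unfolding lower_at_mean_but_last by (simp add: power_divide eval_nat_numeral)
  also have "\<dots> \<le> lower_at_mean n 1"
    using assms by (intro lower_at_mean_one_ge) auto
  finally show ?thesis .
qed simp

lemma lower_at_mean_one_le:
  assumes "2 \<le> n"
  shows "lower_at_mean n 1 \<le> 3 / 4"
proof -
  have "lower_at_mean n 1 \<le> lower_at_mean (Suc 1) 1"
    using assms by (intro lower_at_mean_antimono) auto
  also have "\<dots> = 3 / 4" unfolding lower_at_mean_but_last by (simp add: power_divide)
  finally show ?thesis .
qed

section \<open>From Bernoulli convolutions to polynomials\<close>

lemma pmf_count_successes:
  assumes "finite A" "\<And>j. j \<in> A \<Longrightarrow> 0 \<le> p j \<and> p j \<le> 1"
  shows "pmf (map_pmf (\<lambda>\<omega>. \<Sum>j\<in>A. of_bool (\<omega> j)) (Pi_pmf A False (\<lambda>j. bernoulli_pmf (p j)))) k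
           = coeff (success_poly A p) k"
  using assms
proof (induction A arbitrary: k rule: finite_induct)
  case empty
  then show ?case by (auto simp: success_poly_def pmf_return indicator_def)
next
  case (insert i A)
  let ?S = "\<lambda>\<omega>. \<Sum>j\<in>A. of_bool (\<omega> j) :: nat"
  let ?M = "Pi_pmf A False (\<lambda>j. bernoulli_pmf (p j))"
  have S: "(\<Sum>j\<in>insert i A. of_bool ((fun_upd \<omega> i y) j) :: nat) = of_bool y + ?S \<omega>" for \<omega> y
  proof -
    have "(\<Sum>j\<in>A. of_bool ((fun_upd \<omega> i y) j)) = ?S \<omega>"
      using insert.hyps by (intro sum.cong) auto
    then show ?thesis by (simp only: sum.insert[OF insert.hyps(1,2)] fun_upd_same)
  qed
  have "map_pmf (\<lambda>\<omega>. \<Sum>j\<in>insert i A. of_bool (\<omega> j) :: nat)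
          (Pi_pmf (insert i A) False (\<lambda>j. bernoulli_pmf (p j)))
      = bind_pmf (bernoulli_pmf (p i)) (\<lambda>y. map_pmf (\<lambda>c. of_bool y + c) (map_pmf ?S ?M))"
    by (simp only: Pi_pmf_insert'[OF insert.hyps] map_pmf_def bind_assoc_pmf bind_return_pmf S)
  moreover have "pmf (map_pmf (\<lambda>c. of_bool y + c) N) k
      = (if y then if k = 0 then 0 else pmf N (k - 1) else pmf N k)" for y and N :: "nat pmf"
  proof (cases y)
    case True
    have "pmf (map_pmf Suc N) k = (if k = 0 then 0 else pmf N (k - 1))"
      by (cases k) (auto simp: pmf_map_inj' pmf_map_outside)
    then show ?thesis using True by simp
  next
    case False
    then show ?thesis by (simp add: map_pmf_ident)
  qed
  moreover have "0 \<le> p i" "p i \<le> 1" using insert.prems by auto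
  ultimately show ?case
    by (simp only: pmf_bind integral_bernoulli_pmf insert.IH[OF insert.prems[OF insertI2]]
        success_poly_insert[OF insert.hyps] coeff_linear_factor) simp
qed

lemma pmf_bernoulli_convolution:
  assumes "\<And>j. j \<in> {1..n} \<Longrightarrow> 0 \<le> p j \<and> p j \<le> 1"
  shows "pmf (bernoulli_convolution n p) k = coeff (success_poly {1..n} p) k"
  unfolding bernoulli_convolution_def by (rule pmf_count_successes) (use assms in auto)

lemma prob_bernoulli_convolution_atMost:
  assumes "\<And>j. j \<in> {1..n} \<Longrightarrow> 0 \<le> p j \<and> p j \<le> 1"
  shows "measure_pmf.prob (bernoulli_convolution n p) {..d} = lower_sum d (success_poly {1..n} p)"
  unfolding lower_sum_def measure_measure_pmf_finite[OF finite_atMost]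
  by (intro sum.cong refl pmf_bernoulli_convolution assms)

lemma set_pmf_bernoulli_convolution: "set_pmf (bernoulli_convolution n p) \<subseteq> {..n}"
proof -
  have "(\<Sum>j=1..n. of_bool (\<omega> j) :: nat) \<le> n" for \<omega>
    using sum_bounded_above[of "{1..n}" "\<lambda>j. of_bool (\<omega> j) :: nat" 1] by simp
  then show ?thesis by (auto simp: bernoulli_convolution_def)
qed

lemma binomial_pmf_eq_bernoulli_convolution:
  assumes "0 \<le> a" "a \<le> 1"
  shows "binomial_pmf n a = bernoulli_convolution n (\<lambda>_. a)"
proof -
  have "(\<Sum>j=1..n. of_bool (\<omega> j)) = card {j \<in> {1..n}. \<omega> j}" for \<omega>
    by (simp add: of_bool_def sum.If_cases Int_def)
  then show ?thesis
    using binomial_pmf_altdef'[of "{1..n}" n a False] assms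
    by (simp add: bernoulli_convolution_def)
qed

lemma prob_bernoulli_convolution_atLeast:
  assumes "\<And>j. j \<in> {1..n} \<Longrightarrow> 0 \<le> p j \<and> p j \<le> 1" "1 \<le> x"
  shows "measure_pmf.prob (bernoulli_convolution n p) {x..n}
           = 1 - lower_sum (x - 1) (success_poly {1..n} p)"
proof -
  let ?B = "bernoulli_convolution n p"
  have "measure_pmf.prob ?B {x..n} = measure_pmf.prob ?B (UNIV - {..x - 1})"
    using set_pmf_bernoulli_convolution[of n p] assms(2)
    by (intro measure_pmf.finite_measure_eq_AE) (auto simp: AE_measure_pmf_iff)
  also have "\<dots> = 1 - measure_pmf.prob ?B {..x - 1}"
    using measure_pmf.prob_compl[of "{..x - 1}" ?B] by simp
  finally show ?thesis using prob_bernoulli_convolution_atMost[of n p, OF assms(1)] by simp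
qed

lemma prob_binomial_atLeast:
  assumes "0 \<le> a" "a \<le> 1" "1 \<le> x"
  shows "measure_pmf.prob (binomial_pmf n a) {x..n} = 1 - lower_sum (x - 1) ([:1 - a, a:] ^ n)"
  using prob_bernoulli_convolution_atLeast[of n "\<lambda>_. a" x] assms
  by (simp add: binomial_pmf_eq_bernoulli_convolution success_poly_const)

lemma beta_n_eq_lower_at_mean:
  assumes "1 \<le> n"
  shows "beta_n n = lower_at_mean n 1"
proof -
  have "{0, 1} = {..1::nat}" by auto
  then show ?thesis
    using prob_bernoulli_convolution_atMost[of n "\<lambda>_. 1 / real n" 1] assms
    by (simp add: beta_n_def lower_at_mean_def success_poly_const binomial_pmf_eq_bernoulli_convolution)
qed

lemma reflect_bernoulli_convolution:
  assumes "\<And>j. j \<in> {1..n} \<Longrightarrow> 0 \<le> p j \<and> p j \<le> 1"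
  shows "bernoulli_convolution n (\<lambda>j. 1 - p j) = map_pmf (\<lambda>x. n - x) (bernoulli_convolution n p)"
proof -
  let ?A = "{1..n}"
  let ?S = "\<lambda>\<omega>. \<Sum>j\<in>?A. of_bool (\<omega> j) :: nat"
  let ?P = "\<lambda>c. Pi_pmf ?A c (\<lambda>j. bernoulli_pmf (p j))"
  have neg: "bernoulli_pmf (1 - p j) = map_pmf Not (bernoulli_pmf (p j))" if "j \<in> ?A" for j
  proof (rule pmf_eqI)
    fix b
    have "pmf (map_pmf Not (bernoulli_pmf (p j))) (\<not> (\<not> b)) = pmf (bernoulli_pmf (p j)) (\<not> b)"
      by (rule pmf_map_inj') (auto intro: injI)
    then show "pmf (bernoulli_pmf (1 - p j)) b = pmf (map_pmf Not (bernoulli_pmf (p j))) b"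
      using assms[OF that] by (cases b) simp_all
  qed
  have "Pi_pmf ?A False (\<lambda>j. bernoulli_pmf (1 - p j))
      = Pi_pmf ?A False (\<lambda>j. map_pmf Not (bernoulli_pmf (p j)))"
    using neg by (intro Pi_pmf_cong) auto
  also have "\<dots> = map_pmf (\<lambda>h. Not \<circ> h) (?P True)"
    by (rule Pi_pmf_map) auto
  also have "?P True = map_pmf (\<lambda>f j. if j \<in> ?A then f j else True) (?P False)"
    by (rule Pi_pmf_default_swap[symmetric]) simp
  finally have "bernoulli_convolution n (\<lambda>j. 1 - p j)
      = map_pmf (\<lambda>\<omega>. \<Sum>j\<in>?A. of_bool (\<not> \<omega> j)) (?P False)"
    unfolding bernoulli_convolution_def
    by (auto simp only: map_pmf_comp o_def if_True intro!: map_pmf_cong sum.cong)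
  also have "(\<lambda>\<omega>. \<Sum>j\<in>?A. of_bool (\<not> \<omega> j)) = (\<lambda>\<omega>. n - ?S \<omega>)"
  proof
    fix \<omega> :: "nat \<Rightarrow> bool"
    have "(\<Sum>j\<in>?A. of_bool (\<not> \<omega> j)) + ?S \<omega> = (\<Sum>j\<in>?A. 1)"
      unfolding sum.distrib[symmetric] by (intro sum.cong) auto
    then show "(\<Sum>j\<in>?A. of_bool (\<not> \<omega> j)) = n - ?S \<omega>" by simp
  qed
  finally show ?thesis by (simp add: bernoulli_convolution_def map_pmf_comp)
qed

section \<open>The Clopper-Pearson bounds\<close>

lemma lower_sum_binomial_boundary:
  "lower_sum d ([:1 - 0, 0:] ^ n) = (1 :: real)"
  "d < n \<Longrightarrow> lower_sum d ([:1 - 1, 1:] ^ n) = (0 :: real)"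
proof -
  have "lower_sum d ([:1 - 0, 0:] ^ n) = (\<Sum>k\<le>d. if k = 0 then 1 else 0 :: real)"
    by (simp add: lower_sum_def pCons_one coeff_1)
  then show "lower_sum d ([:1 - 0, 0:] ^ n) = (1 :: real)" by simp
next
  assume "d < n"
  then show "lower_sum d ([:1 - 1, 1:] ^ n) = (0 :: real)"
    unfolding lower_sum_def by (intro sum.neutral) (simp add: coeff_linear_poly_power)
qed

text \<open>The description of \<open>g_CP\<close> is proper: the intermediate value theorem gives existence, strict
  monotonicity of the lower tail gives uniqueness.\<close>

lemma g_CP_properties:
  assumes x: "1 \<le> x" "x \<le> n" and \<gamma>: "0 < \<gamma>" "\<gamma> < 1"
  shows g_CP_bounds: "0 \<le> g_CP n \<gamma> x" "g_CP n \<gamma> x \<le> 1"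
    and lower_sum_g_CP: "lower_sum (x - 1) ([:1 - g_CP n \<gamma> x, g_CP n \<gamma> x:] ^ n) = \<gamma>"
proof -
  let ?F = "\<lambda>a. lower_sum (x - 1) ([:1 - a, a:] ^ n)"
  let ?P = "\<lambda>a. a \<in> {0..1} \<and> measure_pmf.prob (binomial_pmf n a) {x..n} = 1 - \<gamma>"
  have xn: "x - 1 < n" using x by simp
  have P: "?P a \<longleftrightarrow> 0 \<le> a \<and> a \<le> 1 \<and> ?F a = \<gamma>" for a
    using prob_binomial_atLeast[of a x n] x by auto
  have "\<exists>a. 0 \<le> a \<and> a \<le> 1 \<and> ?F a = \<gamma>"
  proof (rule IVT2')
    show "continuous_on {0..1} ?F" by (rule continuous_on_lower_sum_binomial)
    show "?F 1 \<le> \<gamma>" using lower_sum_binomial_boundary(2)[of "x - 1" n] x \<gamma> by simp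
    show "\<gamma> \<le> ?F 0" using lower_sum_binomial_boundary(1)[of "x - 1" n] \<gamma> by simp
  qed simp
  moreover have "a = b" if "0 \<le> a \<and> a \<le> 1 \<and> ?F a = \<gamma>" "0 \<le> b \<and> b \<le> 1 \<and> ?F b = \<gamma>" for a b
    using lower_sum_binomial_strict_antimono[OF xn, of a b]
      lower_sum_binomial_strict_antimono[OF xn, of b a] that
    by (cases a b rule: linorder_cases) auto
  ultimately have "\<exists>!a. ?P a" unfolding P by blast
  then have "?P (g_CP n \<gamma> x)"
    unfolding g_CP_def by (rule theI')
  then show "0 \<le> g_CP n \<gamma> x" "g_CP n \<gamma> x \<le> 1" "?F (g_CP n \<gamma> x) = \<gamma>"
    unfolding P by auto
qed

lemma not_in_K_CP_iff:
  assumes "x \<le> n" "0 < \<gamma>" "\<gamma> < 1" "0 \<le> a" "a \<le> 1"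
  shows "a \<notin> K_CP n \<gamma> x \<longleftrightarrow> 1 \<le> x \<and> \<gamma> \<le> lower_sum (x - 1) ([:1 - a, a:] ^ n)"
proof (cases "x = 0")
  case False
  define g where "g = g_CP n \<gamma> x"
  have x: "1 \<le> x" "x - 1 < n" using False assms by auto
  have g: "0 \<le> g" "g \<le> 1" "lower_sum (x - 1) ([:1 - g, g:] ^ n) = \<gamma>"
    using g_CP_properties[of x n \<gamma>] assms x by (simp_all add: g_def)
  have "a \<le> g \<longleftrightarrow> \<gamma> \<le> lower_sum (x - 1) ([:1 - a, a:] ^ n)"
    using lower_sum_binomial_strict_antimono[OF x(2), of a g]
      lower_sum_binomial_strict_antimono[OF x(2), of g a] assms g
    by (cases a g rule: linorder_cases) auto
  then show ?thesis using False assms by (auto simp: K_CP_def g_def)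
qed (use assms in \<open>simp add: K_CP_def\<close>)

lemma is_interval_K_CP: "is_interval (K_CP n \<gamma> x)"
  by (simp add: K_CP_def is_interval_cc is_interval_oc)

lemma is_interval_M_CP: "is_interval (M_CP n \<beta> x)"
proof -
  have reflect: "is_interval ((\<lambda>t. 1 - t) ` S)" if "is_interval S" for S :: "real set"
    using that by (simp add: is_interval_connected_1)
       (intro connected_continuous_image continuous_intros)
  then show ?thesis
    unfolding M_CP_def Lambda_CP_def by (intro is_interval_Int reflect is_interval_K_CP)
qed

definition missed :: "nat \<Rightarrow> real \<Rightarrow> (nat \<Rightarrow> real) \<Rightarrow> nat set" where
  "missed n \<gamma> p = {x \<in> {0..n}. average n p \<notin> K_CP n \<gamma> x}"

lemma average_bounds:
  assumes "1 \<le> n" "\<And>j. j \<in> {1..n} \<Longrightarrow> 0 \<le> p j \<and> p j \<le> 1"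
  shows "0 \<le> average n p" "average n p \<le> 1" "(\<Sum>j=1..n. p j) = real n * average n p"
proof -
  have "0 \<le> (\<Sum>j=1..n. p j)" "(\<Sum>j=1..n. p j) \<le> real n"
    using sum_nonneg[of "{1..n}" p] sum_bounded_above[of "{1..n}" p 1] assms by auto
  then show "0 \<le> average n p" "average n p \<le> 1" "(\<Sum>j=1..n. p j) = real n * average n p"
    using assms by (simp_all add: average_def)
qed

section \<open>One-sided error probabilities\<close>

text \<open>The hypothesis on \<open>(1 - average n p) ^ n\<close> says that the outcome \<open>1\<close> is covered. The least missed
  outcome is then some \<open>k + 1\<close> with \<open>k \<ge> 1\<close>, and the hypothesis on \<open>\<gamma>\<close> forces the mean to be at most \<open>k\<close>,
  which is where Hoeffding's inequality is available. For \<open>n = 1\<close> no such outcome exists.\<close>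

lemma prob_missed_le:
  assumes n: "1 \<le> n" and p: "\<And>j. j \<in> {1..n} \<Longrightarrow> 0 \<le> p j \<and> p j \<le> 1"
    and \<gamma>: "0 < \<gamma>" "\<gamma> < 1" "n = 1 \<or> beta_n n \<le> \<gamma>"
    and first: "(1 - average n p) ^ n < \<gamma>"
  shows "measure_pmf.prob (bernoulli_convolution n p) (missed n \<gamma> p) \<le> 1 - \<gamma>"
proof (cases "missed n \<gamma> p = {}")
  case False
  define a where "a = average n p"
  have a: "0 \<le> a" "a \<le> 1" "(\<Sum>j=1..n. p j) = real n * a"
    using average_bounds[OF n p] by (simp_all add: a_def)
  have iff: "x \<in> missed n \<gamma> p \<longleftrightarrow> x \<le> n \<and> 1 \<le> x \<and> \<gamma> \<le> lower_sum (x - 1) ([:1 - a, a:] ^ n)" for x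
    using not_in_K_CP_iff[of x n \<gamma> a] \<gamma> a by (auto simp: missed_def a_def)
  define c where "c = (LEAST x. x \<in> missed n \<gamma> p)"
  have c: "c \<in> missed n \<gamma> p"
    using LeastI_ex[of "\<lambda>x. x \<in> missed n \<gamma> p"] False by (auto simp: c_def)
  have sub: "missed n \<gamma> p \<subseteq> {c..n}"
    using iff by (auto simp: c_def intro: Least_le)
  have "c \<noteq> 1"
    using first c unfolding iff
    by (auto simp: lower_sum_def coeff_0_power a_def)
  then obtain k where k: "c = Suc k" "1 \<le> k" "k < n"
    using c unfolding iff by (cases c) auto
  have low: "\<gamma> \<le> lower_sum k ([:1 - a, a:] ^ n)" using c k unfolding iff by simp
  have "a \<le> real k / real n"
  proof (rule ccontr)
    assume "\<not> a \<le> real k / real n"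
    then have "lower_sum k ([:1 - a, a:] ^ n) < lower_at_mean n k"
      unfolding lower_at_mean_def using k a
      by (intro lower_sum_binomial_strict_antimono) auto
    also have "\<dots> \<le> beta_n n"
      using lower_at_mean_le_one[of k n] k n by (simp add: beta_n_eq_lower_at_mean)
    also have "\<dots> \<le> \<gamma>" using \<gamma>(3) k by auto
    finally show False using low by simp
  qed
  then have "real n * a \<le> real k" using n by (simp add: field_simps)
  then have "lower_sum k ([:1 - a, a:] ^ n) \<le> lower_sum k (success_poly {1..n} p)"
    using hoeffding_lower_sum[of "{1..n}" p a k] p a n by simp
  moreover have "measure_pmf.prob (bernoulli_convolution n p) {c..n}
      = 1 - lower_sum k (success_poly {1..n} p)"
    using prob_bernoulli_convolution_atLeast[of n p c] p k by simp
  moreover have "measure_pmf.prob (bernoulli_convolution n p) (missed n \<gamma> p)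
      \<le> measure_pmf.prob (bernoulli_convolution n p) {c..n}"
    using sub by (intro measure_pmf.finite_measure_mono) auto
  ultimately show ?thesis using low by linarith
qed (use \<gamma> in simp)

text \<open>With \<open>s = n * a\<close>, Bernoulli's inequality gives \<open>(1 - a) ^ n * (1 + s) \<le> (1 - a\<^sup>2) ^ n \<le> 1\<close>.
  The hypothesis then yields \<open>s < 1\<close>, and for such \<open>s\<close> one has \<open>1 / (1 + s) \<le> 1 - s / 2\<close>.\<close>

lemma n_mult_le_two_times_prob_pos:
  fixes a :: real
  assumes "0 \<le> a" "a \<le> 1" "1 / 2 < (1 - a) ^ n"
  shows "real n * a \<le> 2 * (1 - (1 - a) ^ n)"
proof -
  define q where "q = (1 - a) ^ n"
  define s where "s = real n * a"
  have s: "0 \<le> s" using assms by (simp add: s_def)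
  have "1 + s \<le> (1 + a) ^ n"
    using Bernoulli_inequality[of a n] assms by (simp add: s_def)
  then have "q * (1 + s) \<le> q * (1 + a) ^ n"
    using assms by (intro mult_left_mono) (auto simp: q_def)
  also have "\<dots> = (1 - a\<^sup>2) ^ n"
    by (simp add: q_def power_mult_distrib[symmetric] power2_eq_square algebra_simps)
  also have "\<dots> \<le> 1"
    using assms by (intro power_le_one) (auto simp: power_le_one)
  finally have *: "q * (1 + s) \<le> 1" .
  have "1 / 2 * (1 + s) < q * (1 + s)"
    using assms s by (intro mult_strict_right_mono) (auto simp: q_def)
  then have s1: "s < 1" using * by simp
  have "1 \<le> (1 - s / 2) * (1 + s)"
    using mult_right_mono[of s 1 s] s s1 by (simp add: algebra_simps)
  then have "q * (1 + s) \<le> (1 - s / 2) * (1 + s)" using * by linarith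
  then have "q \<le> 1 - s / 2" using s by (simp add: mult_le_cancel_right)
  then show ?thesis by (simp add: q_def s_def)
qed

text \<open>If the outcome \<open>1\<close> is missed, all positive outcomes may be missed. Their total probability is at
  most \<open>n * average n p\<close> by the union bound, and the factor \<open>2\<close> pays for the difference between this
  and the corresponding binomial probability.\<close>

lemma prob_missed_le_double:
  assumes n: "1 \<le> n" and p: "\<And>j. j \<in> {1..n} \<Longrightarrow> 0 \<le> p j \<and> p j \<le> 1"
    and \<gamma>: "1 / 2 < \<gamma>" "\<gamma> < 1"
    and first: "\<gamma> \<le> (1 - average n p) ^ n"
  shows "measure_pmf.prob (bernoulli_convolution n p) (missed n \<gamma> p) \<le> 2 * (1 - \<gamma>)"
proof -
  define a where "a = average n p"
  have a: "0 \<le> a" "a \<le> 1" "(\<Sum>j=1..n. p j) = real n * a"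
    using average_bounds[OF n p] by (simp_all add: a_def)
  have "missed n \<gamma> p \<subseteq> {1..n}"
    using not_in_K_CP_iff[of _ n \<gamma> a] \<gamma> a by (auto simp: missed_def a_def)
  then have "measure_pmf.prob (bernoulli_convolution n p) (missed n \<gamma> p)
      \<le> measure_pmf.prob (bernoulli_convolution n p) {1..n}"
    by (intro measure_pmf.finite_measure_mono) auto
  also have "\<dots> = 1 - lower_sum 0 (success_poly {1..n} p)"
    using prob_bernoulli_convolution_atLeast[of n p 1] p by simp
  also have "lower_sum 0 (success_poly {1..n} p) = (\<Prod>j=1..n. 1 - p j)"
    by (simp add: lower_sum_def success_poly_def flip: poly_0_coeff_0) (simp add: poly_prod)
  also have "1 - (\<Prod>j=1..n. 1 - p j) \<le> real n * a"
    using Weierstrass_prod_ineq[of "{1..n}" p] p a by auto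
  also have "\<dots> \<le> 2 * (1 - (1 - a) ^ n)"
    using first \<gamma> a by (intro n_mult_le_two_times_prob_pos) (auto simp: a_def)
  also have "\<dots> \<le> 2 * (1 - \<gamma>)" using first by (simp add: a_def)
  finally show ?thesis .
qed

text \<open>The reflected binomial variable equals \<open>n\<close> with probability \<open>(1 - average n p) ^ n > 1 - \<gamma>\<close>, so all
  its upper tails exceed \<open>1 - \<gamma>\<close>.\<close>

lemma missed_reflection_empty:
  assumes n: "1 \<le> n" and p: "\<And>j. j \<in> {1..n} \<Longrightarrow> 0 \<le> p j \<and> p j \<le> 1"
    and \<gamma>: "1 / 2 < \<gamma>" "\<gamma> < 1"
    and first: "\<gamma> \<le> (1 - average n p) ^ n"
  shows "missed n \<gamma> (\<lambda>j. 1 - p j) = {}"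
proof -
  define b where "b = 1 - average n p"
  have b: "0 \<le> b" "b \<le> 1" using average_bounds[OF n p] by (simp_all add: b_def)
  have avg: "average n (\<lambda>j. 1 - p j) = b"
    using n by (simp add: average_def b_def sum_subtractf field_simps)
  obtain m where m: "n = Suc m" using n by (cases n) auto
  have "lower_sum (x - 1) ([:1 - b, b:] ^ n) < \<gamma>" if "1 \<le> x" "x \<le> n" for x
  proof -
    have "lower_sum (x - 1) ([:1 - b, b:] ^ n) \<le> lower_sum m ([:1 - b, b:] ^ n)"
      unfolding lower_sum_def using that m b coeff_success_poly_nonneg[of "{..<n}" "\<lambda>_. b"]
      by (intro sum_mono2) (auto simp: success_poly_const)
    also have "\<dots> = 1 - b ^ n" unfolding m by (rule lower_sum_binomial_but_last)
    finally show ?thesis using first \<gamma> by (simp add: b_def)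
  qed
  then show ?thesis
    using not_in_K_CP_iff[of _ n \<gamma> b] \<gamma> b by (fastforce simp: missed_def avg)
qed

section \<open>The two-sided interval\<close>

text \<open>Not covering the average means that one of the two one-sided bounds fails, and the lower bound
  fails at \<open>x\<close> exactly if the upper bound fails at \<open>n - x\<close> for the complementary probabilities.\<close>

lemma coverage_M_CP_ge:
  assumes n: "1 \<le> n" and p: "\<And>j. j \<in> {1..n} \<Longrightarrow> 0 \<le> p j \<and> p j \<le> 1"
  shows "1 - measure_pmf.prob (bernoulli_convolution n p) (missed n ((1 + \<beta>) / 2) p)
      - measure_pmf.prob (bernoulli_convolution n (\<lambda>j. 1 - p j)) (missed n ((1 + \<beta>) / 2) (\<lambda>j. 1 - p j))
    \<le> measure_pmf.prob (bernoulli_convolution n p) {x \<in> {0..n}. average n p \<in> M_CP n \<beta> x}"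
proof -
  let ?B = "bernoulli_convolution n p"
  let ?\<gamma> = "(1 + \<beta>) / 2"
  let ?U = "missed n ?\<gamma> p"
  let ?V = "(\<lambda>x. n - x) -` missed n ?\<gamma> (\<lambda>j. 1 - p j)"
  let ?C = "{x \<in> {0..n}. average n p \<in> M_CP n \<beta> x}"
  have avg: "average n (\<lambda>j. 1 - p j) = 1 - average n p"
    using n by (simp add: average_def sum_subtractf field_simps)
  have "average n p \<in> Lambda_CP n ?\<gamma> x \<longleftrightarrow> 1 - average n p \<in> K_CP n ?\<gamma> (n - x)" for x
    unfolding Lambda_CP_def by (force intro: image_eqI[of _ _ "1 - average n p"])
  then have cover: "{..n} \<subseteq> ?C \<union> (?U \<union> ?V)"
    by (auto simp: missed_def M_CP_def avg)
  have "1 = measure_pmf.prob ?B {..n}"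
    using set_pmf_bernoulli_convolution[of n p]
    by (subst eq_commute, subst measure_pmf.prob_eq_1) (auto simp: AE_measure_pmf_iff)
  also have "\<dots> \<le> measure_pmf.prob ?B (?C \<union> (?U \<union> ?V))"
    using cover by (intro measure_pmf.finite_measure_mono) auto
  also have "\<dots> \<le> measure_pmf.prob ?B ?C + measure_pmf.prob ?B (?U \<union> ?V)"
    by (rule measure_Un_le) auto
  also have "measure_pmf.prob ?B (?U \<union> ?V) \<le> measure_pmf.prob ?B ?U + measure_pmf.prob ?B ?V"
    by (rule measure_Un_le) auto
  also have "measure_pmf.prob ?B ?V
      = measure_pmf.prob (bernoulli_convolution n (\<lambda>j. 1 - p j)) (missed n ?\<gamma> (\<lambda>j. 1 - p j))"
    by (subst reflect_bernoulli_convolution[where p = p]) (use p in auto)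
  finally show ?thesis by linarith
qed

theorem theorem1p12:
  fixes n :: nat and \<beta> :: real
  assumes "n \<ge> 1" and "0 < \<beta>" and "\<beta> < 1"
  shows "(\<beta> \<ge> 2 * beta_n n - 1 \<or> n = 1 \<longrightarrow>
            confidence_interval_for_average n \<beta> (M_CP n \<beta>)) \<and>
         (\<beta> \<ge> 1 / 2 \<longrightarrow> \<beta> \<ge> 2 * beta_n n - 1 \<or> n = 1)"
proof (intro conjI impI)
  assume "\<beta> \<ge> 1 / 2"
  then show "\<beta> \<ge> 2 * beta_n n - 1 \<or> n = 1"
    using lower_at_mean_one_le[of n] beta_n_eq_lower_at_mean[of n] assms(1)
    by (cases "n = 1") auto
next
  assume H: "\<beta> \<ge> 2 * beta_n n - 1 \<or> n = 1"
  define \<gamma> where "\<gamma> = (1 + \<beta>) / 2"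
  have \<gamma>: "0 < \<gamma>" "1 / 2 < \<gamma>" "\<gamma> < 1" "n = 1 \<or> beta_n n \<le> \<gamma>"
    using H assms by (auto simp: \<gamma>_def)
  have "\<beta> \<le> measure_pmf.prob (bernoulli_convolution n p) {x \<in> {0..n}. average n p \<in> M_CP n \<beta> x}"
    if "\<forall>j\<in>{1..n}. p j \<in> {0..1}" for p
  proof -
    define q where "q = (\<lambda>j. 1 - p j)"
    have p: "0 \<le> p j \<and> p j \<le> 1" and q: "0 \<le> q j \<and> q j \<le> 1" if "j \<in> {1..n}" for j
      using that \<open>\<forall>j\<in>{1..n}. p j \<in> {0..1}\<close> by (auto simp: q_def)
    have pq: "p = (\<lambda>j. 1 - q j)" by (simp add: q_def)
    let ?miss = "\<lambda>r. measure_pmf.prob (bernoulli_convolution n r) (missed n \<gamma> r)"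
    have \<gamma>\<beta>: "2 * (1 - \<gamma>) = 1 - \<beta>" by (simp add: \<gamma>_def field_simps)
    have "?miss p + ?miss q \<le> 1 - \<beta>"
    proof (cases "\<gamma> \<le> (1 - average n p) ^ n")
      case True
      have "missed n \<gamma> q = {}"
        unfolding q_def by (rule missed_reflection_empty) (use assms p \<gamma> True in auto)
      moreover have "?miss p \<le> 2 * (1 - \<gamma>)"
        by (rule prob_missed_le_double) (use assms p \<gamma> True in auto)
      ultimately show ?thesis using \<gamma>\<beta> by simp
    next
      case p_inner: False
      show ?thesis
      proof (cases "\<gamma> \<le> (1 - average n q) ^ n")
        case True
        have "missed n \<gamma> p = {}"
          unfolding pq by (rule missed_reflection_empty) (use assms q \<gamma> True in auto)
        moreover have "?miss q \<le> 2 * (1 - \<gamma>)"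
          by (rule prob_missed_le_double) (use assms q \<gamma> True in auto)
        ultimately show ?thesis using \<gamma>\<beta> by simp
      next
        case False
        have "?miss p \<le> 1 - \<gamma>" "?miss q \<le> 1 - \<gamma>"
          by (rule prob_missed_le; use assms p q \<gamma> False p_inner in auto)+
        then have "?miss p + ?miss q \<le> (1 - \<gamma>) + (1 - \<gamma>)" by (rule add_mono)
        then show ?thesis using \<gamma>\<beta> by simp
      qed
    qed
    then show ?thesis
      using coverage_M_CP_ge[of n p \<beta>] assms p by (simp add: \<gamma>_def q_def)
  qed
  then show "confidence_interval_for_average n \<beta> (M_CP n \<beta>)"
    unfolding confidence_interval_for_average_def using is_interval_M_CP by blast
qed

end
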